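(* For every real $r>0$, $$S_1(r)=-\int_r^\infty\varphi_1(t)\,\frac{dt}{t^2}.$$
   Context: Notation: $H(x)=\sum_{1\le k\le x}1/k$ for $x>0$ (empty sums are $0$), $\{x\}=x-\lfloor x\rfloor$ is the fractional part, $\gamma$ is Euler's constant. For $x>0$, $R_1(x)=\log x+\gamma-H(x)-\frac{\{x\}-1/2}{x}$ and $S_1(x)=\sum_{k\ge1}R_1(kx)$ (absolutely convergent for every $x>0$). The function $\varphi_1$ is defined for almost every $t>0$ by $$\varphi_1(t)=\sum_{k\ge1}\frac{\{kt\}-1/2}{k}.$$ *)

theory Defs
  imports "HOL-Analysis.Analysis"
begin

definition H :: "real \<Rightarrow> real" where
  "H x = harm (nat \<lfloor>x\<rfloor>)"

definition R1 :: "real \<Rightarrow> real" where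
  "R1 x = ln x + euler_mascheroni - H x - (frac x - 1/2) / x"

text \<open>Library series are indexed from 0, hence the shifts by \<open>Suc\<close>.\<close>

definition S1 :: "real \<Rightarrow> real" where
  "S1 x = (\<Sum>k. R1 (real (Suc k) * x))"

text \<open>The series converges only for almost every \<open>t\<close>, and then in general only conditionally,
  so the order of summation matters. On the exceptional null set the value of \<open>phi1\<close>
  is an unspecified constant, which does not affect Lebesgue integrals.\<close>

definition phi1 :: "real \<Rightarrow> real" where
  "phi1 t = (\<Sum>k. (frac (real (Suc k) * t) - 1/2) / real (Suc k))"

end

theory Submission
  imports Defs "HOL-Library.Discrete_Functions"
begin

text \<open>With \<open>B(t) = {t} - 1/2\<close>, integrating \<open>R1' = B(t) / t\<^sup>2\<close> gives \<open>R1(x) = - \<integral>\<^sub>x\<^sup>\<infinity> B(t) dt / t\<^sup>2\<close>, hence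
  \<open>R1(k r) = - \<integral>\<^sub>r\<^sup>\<infinity> (B(k t) / k) dt / t\<^sup>2\<close>, and everything rests on interchanging sum and integral. Group
  the series into blocks \<open>D m\<close> over \<open>m\<^sup>2 < k \<le> (m + 1)\<^sup>2\<close>. Since \<open>\<integral>\<^sub>0\<^sup>1 B(j t) B(k t) dt = gcd(j,k)\<^sup>2 / (12 j k)\<close>
  and \<open>gcd(j,k) \<le> 2 m\<close> for distinct \<open>j, k\<close> in a block, \<open>\<integral>\<^sub>0\<^sup>1 (D m)\<^sup>2 = O(m powr -3)\<close>, so the blocks are
  summable in \<open>L\<^sup>1\<close>; this gives convergence almost everywhere along squares and termwise
  integration. Because the terms are \<open>O(1/k)\<close>, a block contributes only \<open>O(1/m)\<close> in absolute value,
  so convergence along the squares implies convergence of the full series.\<close>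

section \<open>The sawtooth function and its sums over arithmetic progressions\<close>

definition saw :: "real \<Rightarrow> real" where
  "saw t = frac t - 1/2"

lemma saw_bound: "\<bar>saw t\<bar> \<le> 1/2"
  using frac_ge_0[of t] frac_lt_1[of t] unfolding saw_def by (auto simp: abs_if)

lemma saw_add_of_int: "saw (t + of_int n) = saw t"
  by (simp add: saw_def)

lemma saw_add_of_nat: "saw (t + real n) = saw t"
  using saw_add_of_int[of t "int n"] by simp

lemma saw_measurable [measurable]: "saw \<in> borel_measurable borel"
  unfolding saw_def frac_def by measurable

text \<open>The difference \<open>F\<close> of the two sides has period \<open>1 / n\<close>, so it
  suffices to evaluate it on \<open>[0, 1/n)\<close>. There no argument on the left reaches 1 and
  both sides are explicit linear functions.\<close>

lemma sum_saw_equidistributed: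
  assumes "n > 0"
  shows "(\<Sum>i<n. saw (x + real i / real n)) = saw (real n * x)"
proof -
  define F where "F = (\<lambda>x. (\<Sum>i<n. saw (x + real i / real n)) - saw (real n * x))"
  have step: "F (x + 1 / real n) = F x" for x
  proof -
    define h where "h = (\<lambda>i. saw (x + real i / real n))"
    \<comment> \<open>Shifting by \<open>1 / n\<close> rotates the sum: the new term
      \<open>h n\<close> equals the lost term \<open>h 0\<close>, because \<open>saw\<close> has
      period 1.\<close>
    have "h n = h 0"
      using assms saw_add_of_nat[of x 1] by (simp add: h_def)
    moreover have "(\<Sum>i<Suc n. h i) = h 0 + (\<Sum>i<n. h (Suc i))"
      by (rule sum.lessThan_Suc_shift)
    ultimately have "(\<Sum>i<n. h (Suc i)) = (\<Sum>i<n. h i)"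
      by simp
    moreover have "h (Suc i) = saw (x + 1 / real n + real i / real n)" for i
      by (simp add: h_def add_divide_distrib algebra_simps)
    moreover have "saw (real n * (x + 1 / real n)) = saw (real n * x)"
      using assms saw_add_of_nat[of "real n * x" 1] by (simp add: algebra_simps)
    ultimately show ?thesis
      by (simp add: F_def h_def)
  qed
  have steps: "F (x + real m / real n) = F x" for x m
  proof (induction m)
    case (Suc m)
    have "x + real (Suc m) / real n = (x + real m / real n) + 1 / real n"
      by (simp add: add_divide_distrib)
    then show ?case
      using step Suc by metis
  qed simp
  \<comment> \<open>Removing \<open>m\<close> whole steps of length \<open>1 / n\<close> from
    \<open>frac x\<close> leaves \<open>y\<close> in \<open>[0, 1/n)\<close>.\<close>
  define m where "m = nat \<lfloor>real n * frac x\<rfloor>"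
  define y where "y = frac x - real m / real n"
  have "real m \<le> real n * frac x" "real n * frac x < real m + 1"
    unfolding m_def by (auto simp: of_nat_nat)
  moreover have "real n * y = real n * frac x - real m"
    using assms by (simp add: y_def right_diff_distrib)
  ultimately have "0 \<le> real n * y" and "real n * y < 1"
    by linarith+
  then have y: "0 \<le> y" "real n * y < 1"
    using assms by (auto simp: zero_le_mult_iff)
  have "saw (y + real i / real n) = y + real i / real n - 1/2" if "i < n" for i
  proof -
    have "real i + 1 \<le> real n"
      using that by linarith
    then have "y + real i / real n < 1"
      using y assms by (simp add: field_simps)
    then have "frac (y + real i / real n) = y + real i / real n"
      using y by (simp add: frac_eq)
    then show ?thesis
      by (simp add: saw_def)
  qed
  then have "(\<Sum>i<n. saw (y + real i / real n)) = (\<Sum>i<n. (y - 1/2) + real i / real n)"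
    by (intro sum.cong) auto
  also have "\<dots> = real n * (y - 1/2) + (\<Sum>i<n. real i) / real n"
    by (simp add: sum.distrib sum_divide_distrib)
  also have "(\<Sum>i<n. real i) = real n * (real n - 1) / 2"
    by (induction n) (auto simp: field_simps)
  also have "real n * (y - 1/2) + real n * (real n - 1) / 2 / real n = real n * y - 1/2"
    using assms by (simp add: field_simps)
  also have "\<dots> = saw (real n * y)"
    using y by (simp add: saw_def frac_eq)
  finally have "F y = 0"
    by (simp add: F_def)
  then have "F (frac x) = 0"
    using steps[of y m] by (simp add: y_def)
  moreover have "saw (frac x + z) = saw (x + z)" for z
    using saw_add_of_int[of "frac x + z" "\<lfloor>x\<rfloor>"] by (simp add: frac_def algebra_simps)
  moreover have "saw (real n * frac x) = saw (real n * x)"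
    using saw_add_of_int[of "real n * frac x" "int n * \<lfloor>x\<rfloor>"] by (simp add: frac_def algebra_simps)
  ultimately show ?thesis
    by (simp add: F_def)
qed

text \<open>Multiplication by \<open>c\<close> permutes the residues modulo \<open>n\<close>, and by
  periodicity \<open>saw\<close> sees only the residue of \<open>c * i\<close>.\<close>

lemma sum_saw_coprime:
  assumes "n > 0" "coprime c n"
  shows "(\<Sum>i<n. saw (x + real (c * i) / real n)) = saw (real n * x)"
proof -
  have "inj_on (\<lambda>i. (c * i) mod n) {..<n}"
  proof (rule inj_onI)
    fix i j assume *: "i \<in> {..<n}" "j \<in> {..<n}" "c * i mod n = c * j mod n"
    have "i mod n = j mod n" if "j \<le> i" "c * i mod n = c * j mod n" for i j
    proof -
      have "n dvd c * (i - j)"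
        using that by (metis mod_eq_dvd_iff_nat mult_le_mono2 diff_mult_distrib2)
      then have "n dvd i - j"
        using assms(2) by (simp add: coprime_commute coprime_dvd_mult_right_iff)
      then show ?thesis
        using that by (simp add: mod_eq_dvd_iff_nat)
    qed
    from this[of i j] this[of j i] have "i mod n = j mod n"
      using * by (metis nat_le_linear)
    with * show "i = j"
      by simp
  qed
  moreover have "(\<lambda>i. (c * i) mod n) ` {..<n} \<subseteq> {..<n}"
    using assms by auto
  ultimately have "bij_betw (\<lambda>i. (c * i) mod n) {..<n} {..<n}"
    by (simp add: bij_betw_def endo_inj_surj)
  then have "(\<Sum>i<n. saw (x + real (c * i mod n) / real n)) = (\<Sum>i<n. saw (x + real i / real n))"
    by (rule sum.reindex_bij_betw)
  moreover have "saw (x + real (c * i) / real n) = saw (x + real (c * i mod n) / real n)" for i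
  proof -
    have "real (c * i) = real n * real (c * i div n) + real (c * i mod n)"
      by (metis mult_div_mod_eq of_nat_add of_nat_mult)
    then have "x + real (c * i) / real n = (x + real (c * i mod n) / real n) + real (c * i div n)"
      using assms by (simp add: field_simps)
    then show ?thesis
      by (simp only: saw_add_of_nat)
  qed
  ultimately show ?thesis
    using sum_saw_equidistributed[OF assms(1)] by simp
qed

text \<open>After cancelling \<open>d = gcd a b\<close> the progression has modulus
  \<open>a' = a div d\<close> and a step coprime to it, so \<open>i < a\<close> runs through
  \<open>d\<close> full periods, each contributing \<open>saw (a' * x)\<close>.\<close>

lemma sum_saw_gcd:
  assumes "a > 0"
  shows "(\<Sum>i<a. saw (x + real (b * i) / real a)) = real (gcd a b) * saw (real (a div gcd a b) * x)"
proof -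
  define d where "d = gcd a b"
  define a' where "a' = a div d"
  define b' where "b' = b div d"
  have d: "d > 0" and a: "a = d * a'" and b: "b = d * b'"
    using assms by (auto simp: d_def a'_def b'_def)
  have a': "a' > 0"
    using assms a by (cases a') auto
  have cop: "coprime b' a'"
    using assms unfolding a'_def b'_def d_def
    by (metis coprime_commute div_gcd_coprime less_not_refl)
  define G where "G = (\<lambda>i. saw (x + real (b' * i) / real a'))"
  have "saw (x + real (b * i) / real a) = G i" for i
    using d by (simp add: a b G_def)
  then have "(\<Sum>i<a. saw (x + real (b * i) / real a)) = (\<Sum>i<d * a'. G i)"
    by (simp add: a)
  also have "\<dots> = (\<Sum>m<d. sum G {m * a'..<m * a' + a'})"
    by (rule sum.nat_group[symmetric])
  also have "\<dots> = (\<Sum>m<d. saw (real a' * x))"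
  proof (rule sum.cong)
    fix m
    have "sum G {m * a'..<m * a' + a'} = sum (\<lambda>i. G (i + m * a')) {0..<a'}"
      using sum.shift_bounds_nat_ivl[of G 0 "m * a'" a'] by (simp add: add.commute)
    also have "\<dots> = sum G {..<a'}"
    proof (rule sum.cong)
      fix i
      have "x + real (b' * (i + m * a')) / real a' = (x + real (b' * i) / real a') + real (b' * m)"
        using a' by (simp add: field_simps)
      then show "G (i + m * a') = G i"
        by (simp only: G_def saw_add_of_nat)
    qed auto
    also have "\<dots> = saw (real a' * x)"
      unfolding G_def using sum_saw_coprime[OF a' cop] .
    finally show "sum G {m * a'..<m * a' + a'} = saw (real a' * x)" .
  qed simp
  finally show ?thesis
    by (simp add: a'_def d_def)
qed

section \<open>Integrals of products of dilated sawtooths over one period\<close>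

lemma set_integrable_bounded_Ico:
  fixes f :: "real \<Rightarrow> real"
  assumes [measurable]: "f \<in> borel_measurable borel" and "\<And>x. \<bar>f x\<bar> \<le> C"
  shows "set_integrable lborel {a..<b} f"
proof -
  have "emeasure lborel {a..<b} < \<infinity>"
    by (rule emeasure_bounded_finite) (auto intro: bounded_subset[OF bounded_closed_interval[of a b]])
  then show ?thesis
    unfolding set_integrable_def
    by (intro integrableI_bounded_set_indicator[where B = C]) (use assms(2) in auto)
qed

text \<open>The half-open pieces \<open>[i/n, (i+1)/n)\<close> are disjoint, and
  \<open>t = (u + i) / n\<close> maps \<open>[0,1)\<close> onto each of them with Jacobian
  \<open>1 / n\<close>. The induction adds one piece at a time.\<close>

lemma LBINT_unit_subdivision:
  fixes f :: "real \<Rightarrow> real"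
  assumes "set_integrable lborel {0..<1} f" "n > 0"
  shows "(LBINT t:{0..<1}. f t) = (\<Sum>i<n. LBINT u:{0..<1}. f ((u + real i) / real n)) / real n"
proof -
  have "(LBINT t:{0..<real m / real n}. f t) = (\<Sum>i<m. LBINT u:{0..<1}. f ((u + real i) / real n)) / real n"
    if "m \<le> n" for m
    using that
  proof (induction m)
    case (Suc m)
    have le: "real (Suc m) / real n \<le> 1" "real m / real n \<le> real (Suc m) / real n"
      using Suc.prems assms by (auto simp: field_simps)
    have un: "{0..<real (Suc m) / real n} = {0..<real m / real n} \<union> {real m / real n..<real (Suc m) / real n}"
      using le by (intro ivl_disj_un_two(3)[symmetric]) auto
    have "(LBINT t:{0..<real (Suc m) / real n}. f t) =
          (LBINT t:{0..<real m / real n}. f t) + (LBINT t:{real m / real n..<real (Suc m) / real n}. f t)"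
      unfolding un
    proof (rule set_integral_Un)
      show "set_integrable lborel {0..<real m / real n} f"
        by (rule set_integrable_subset[OF assms(1)]) (use le in auto)
      show "set_integrable lborel {real m / real n..<real (Suc m) / real n} f"
        by (rule set_integrable_subset[OF assms(1)]) (use le in \<open>auto intro: order_trans[rotated]\<close>)
    qed auto
    also have "(LBINT t:{real m / real n..<real (Suc m) / real n}. f t) =
               (LBINT u:{0..<1}. f ((u + real m) / real n)) / real n"
    proof -
      have ind: "indicator {real m / real n..<real (Suc m) / real n} (real m / real n + 1 / real n * u)
              = (indicator {0..<1} u :: real)" for u
        using assms(2) by (auto simp: indicator_def field_simps)
      show ?thesis
        unfolding set_lebesgue_integral_def
        using lborel_integral_real_affine[of "1 / real n"
            "\<lambda>t. indicator {real m / real n..<real (Suc m) / real n} t *\<^sub>R f t" "real m / real n"]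
          assms(2)
        by (simp only: ind) (simp add: add_divide_distrib add.commute)
    qed
    finally show ?case
      using Suc by (simp add: add_divide_distrib)
  qed (simp add: set_lebesgue_integral_def)
  from this[of n] assms(2) show ?thesis
    by simp
qed

text \<open>Subdividing \<open>[0,1)\<close> into \<open>a\<close> pieces makes the first factor \<open>saw u\<close> on each of them, while
  the second factor gets summed over an arithmetic progression of residues modulo \<open>a\<close>.\<close>

lemma LBINT_saw_mult_saw_reduce:
  fixes a b :: nat
  assumes "a > 0"
  shows "(LBINT t:{0..<1}. saw (real a * t) * saw (real b * t)) =
    real (gcd a b) / real a * (LBINT u:{0..<1}. saw u * saw (real (b div gcd a b) * u))"
proof -
  have bd: "\<bar>saw x * saw y\<bar> \<le> 1/4" for x y
    using mult_mono[OF saw_bound[of x] saw_bound[of y]] by (simp add: abs_mult)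
  have int: "set_integrable lborel {0..<1} (\<lambda>t. saw (real a * t) * saw (real b * t))"
    by (rule set_integrable_bounded_Ico[OF _ bd]) measurable
  have d: "real a / real (gcd a b) = real (a div gcd a b)" "real b / real (gcd a b) = real (b div gcd a b)"
    by (simp_all add: real_of_nat_div)
  have "(LBINT t:{0..<1}. saw (real a * t) * saw (real b * t)) =
     (\<Sum>i<a. LBINT u:{0..<1}. saw (u + real i) * saw (real b * ((u + real i) / real a))) / real a"
    using assms by (subst LBINT_unit_subdivision[OF int assms]) simp
  also have "\<dots> = (LBINT u:{0..<1}. \<Sum>i<a. saw (u + real i) * saw (real b * ((u + real i) / real a))) / real a"
  proof -
    have "set_integrable lborel {0..<1} (\<lambda>u. saw (u + real i) * saw (real b * ((u + real i) / real a)))" for i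
      by (rule set_integrable_bounded_Ico[OF _ bd]) measurable
    then show ?thesis
      unfolding set_integrable_def set_lebesgue_integral_def
      by (simp add: sum_distrib_left flip: Bochner_Integration.integral_sum)
  qed
  also have "(\<lambda>u. \<Sum>i<a. saw (u + real i) * saw (real b * ((u + real i) / real a))) =
             (\<lambda>u. real (gcd a b) * (saw u * saw (real (b div gcd a b) * u)))"
  proof
    fix u
    have "(\<Sum>i<a. saw (u + real i) * saw (real b * ((u + real i) / real a))) =
          saw u * (\<Sum>i<a. saw (real b * u / real a + real (b * i) / real a))"
      by (simp add: saw_add_of_nat sum_distrib_left add_divide_distrib algebra_simps)
    also have "\<dots> = saw u * (real (gcd a b) * saw (real (a div gcd a b) * (real b * u / real a)))"
      by (subst sum_saw_gcd[OF assms]) simp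
    also have "real (a div gcd a b) * (real b * u / real a) = real (b div gcd a b) * u"
      using assms by (simp flip: d)
    finally show "(\<Sum>i<a. saw (u + real i) * saw (real b * ((u + real i) / real a))) =
        real (gcd a b) * (saw u * saw (real (b div gcd a b) * u))"
      by simp
  qed
  finally show ?thesis
    by simp
qed

lemma LBINT_saw_square: "(LBINT t:{0..<1}. saw t * saw t) = 1/12"
proof -
  have "((\<lambda>t. (t - 1/2)^2 :: real) has_integral ((1 - 1/2)^3/3 - (0 - 1/2)^3/3)) {0..1}"
    by (rule fundamental_theorem_of_calculus)
       (auto intro!: derivative_eq_intros simp flip: has_real_derivative_iff_has_vector_derivative)
  then have I: "integral {0..1} (\<lambda>t. (t - 1/2)^2 :: real) = 1/12"
    by (simp add: integral_unique power3_eq_cube)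
  have "(LBINT t:{0..<1}. saw t * saw t) = (LBINT t:{0..<1}. (t - 1/2)^2)"
    by (rule set_lebesgue_integral_cong) (auto simp: saw_def power2_eq_square)
  \<comment> \<open>The endpoint is a null set; adding it gives the compact interval on which
    \<open>I\<close> was computed.\<close>
  also have "\<dots> = (LBINT t:{0..1}. (t - 1/2)^2)"
    by (rule set_integral_discrete_difference[where X = "{1}"]) auto
  also have "\<dots> = integral {0..1} (\<lambda>t. (t - 1/2)^2)"
    by (rule set_borel_integral_eq_integral)
      (auto intro!: borel_integrable_atLeastAtMost' continuous_intros)
  finally show ?thesis
    using I by simp
qed

text \<open>The reduction is used twice: for \<open>(a, b)\<close>, and for \<open>(c, 1)\<close>
  with the factors exchanged, where the gcd is 1 and only the integral of \<open>saw\<close> squared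
  is left.\<close>

lemma LBINT_saw_mult_saw:
  fixes a b :: nat
  assumes "a > 0" "b > 0"
  shows "(LBINT t:{0..<1}. saw (real a * t) * saw (real b * t)) = real (gcd a b)^2 / (12 * real a * real b)"
proof -
  define c where "c = b div gcd a b"
  have c: "c > 0" "real c = real b / real (gcd a b)"
    using assms by (auto simp: c_def real_of_nat_div div_greater_zero_iff gcd_le2_nat)
  have "(LBINT u:{0..<1}. saw u * saw (real c * u)) = (LBINT u:{0..<1}. saw (real c * u) * saw (real 1 * u))"
    by (simp add: mult.commute)
  also have "\<dots> = 1 / (12 * real c)"
    using LBINT_saw_mult_saw_reduce[OF c(1), of 1] LBINT_saw_square by simp
  finally have "(LBINT u:{0..<1}. saw u * saw (real c * u)) = real (gcd a b) / (12 * real b)"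
    by (simp add: c(2))
  then show ?thesis
    using LBINT_saw_mult_saw_reduce[OF assms(1), of b]
    by (simp add: c_def[symmetric] power2_eq_square)
qed

section \<open>From convergence along the squares to convergence of a series\<close>

text \<open>With \<open>q\<close> the integer square root of \<open>n\<close>, at most
  \<open>2 q\<close> terms separate the partial sum at \<open>n\<close> from the one at
  \<open>q^2\<close>. Each is at most \<open>C / q^2\<close>, so the gap is \<open>O(1/q)\<close>.
  This serves both the pointwise series of \<open>phi1\<close> and the series of
  \<open>R1\<close>.\<close>

lemma sums_of_square_partial_sums:
  fixes a :: "nat \<Rightarrow> real"
  assumes bound: "\<And>k. \<bar>a k\<bar> \<le> C / real (Suc k)"
    and lim: "(\<lambda>m. \<Sum>k<m\<^sup>2. a k) \<longlonglongrightarrow> L"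
  shows "a sums L"
proof -
  define q where "q = floor_sqrt"
  have q: "(q n)\<^sup>2 \<le> n" "n \<le> (q n)\<^sup>2 + 2 * q n" for n
    using Suc_floor_sqrt_power2_gt[of n] floor_sqrt_power2_le[of n] by (auto simp: q_def power2_eq_square)
  have C: "C \<ge> 0"
    using bound[of 0] by simp
  have q_top: "filterlim q at_top sequentially"
    unfolding filterlim_at_top
  proof
    fix Z
    have "\<forall>n\<ge>Z\<^sup>2. Z \<le> q n"
      unfolding q_def using mono_floor_sqrt[THEN monoD] floor_sqrt_inverse_power2 by metis
    then show "\<forall>\<^sub>F n in sequentially. Z \<le> q n"
      unfolding eventually_sequentially by blast
  qed
  have gap: "\<bar>(\<Sum>k<n. a k) - (\<Sum>k<(q n)\<^sup>2. a k)\<bar> \<le> 2 * C / real (q n)" for n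
  \<comment> \<open>Here \<open>q n = 0\<close> forces \<open>n = 0\<close>, so the sums are empty,
    and the bound is 0 as well since division by zero yields 0.\<close>
  proof (cases "q n = 0")
    case True
    with q[of n] show ?thesis by simp
  next
    case False
    have "(\<Sum>k<n. a k) - (\<Sum>k<(q n)\<^sup>2. a k) = (\<Sum>k=(q n)\<^sup>2..<n. a k)"
      using q(1)[of n] by (simp add: sum_diff_nat_ivl lessThan_atLeast0)
    also have "\<bar>\<dots>\<bar> \<le> (\<Sum>k=(q n)\<^sup>2..<n. \<bar>a k\<bar>)"
      by (rule sum_abs)
    also have "\<dots> \<le> (\<Sum>k=(q n)\<^sup>2..<n. C / (real (q n))\<^sup>2)"
    proof (rule sum_mono)
      fix k assume "k \<in> {(q n)\<^sup>2..<n}"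
      then have "(real (q n))\<^sup>2 \<le> real (Suc k)"
        by (simp flip: of_nat_power)
      then have "C / real (Suc k) \<le> C / (real (q n))\<^sup>2"
        using False C by (intro divide_left_mono) auto
      with bound[of k] show "\<bar>a k\<bar> \<le> C / (real (q n))\<^sup>2"
        by linarith
    qed
    also have "\<dots> = real (n - (q n)\<^sup>2) * (C / (real (q n))\<^sup>2)"
      by simp
    also have "\<dots> \<le> real (2 * q n) * (C / (real (q n))\<^sup>2)"
      using q(2)[of n] C by (intro mult_right_mono) auto
    also have "\<dots> = 2 * C / real (q n)"
      using False by (simp add: power2_eq_square)
    finally show ?thesis .
  qed
  have "(\<lambda>n. 2 * C / real (q n)) \<longlonglongrightarrow> 0"
    by (intro tendsto_divide_0[OF tendsto_const] filterlim_at_top_imp_at_infinity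
        filterlim_compose[OF filterlim_real_sequentially q_top])
  then have "(\<lambda>n. (\<Sum>k<n. a k) - (\<Sum>k<(q n)\<^sup>2. a k)) \<longlonglongrightarrow> 0"
    by (rule Lim_null_comparison[rotated]) (use gap in simp)
  from tendsto_add[OF this filterlim_compose[OF lim q_top]] show ?thesis
    by (simp add: sums_def)
qed

section \<open>Integrals of periodic functions against \<open>1 / t^2\<close>\<close>

text \<open>For \<open>r \<le> t\<close> and \<open>n \<le> t < n + 1\<close> one has \<open>n + 1 \<le> (1 + 1/r) t\<close>, so the weight \<open>1 / t\<^sup>2\<close> on
  \<open>{r..}\<close> is at most \<open>(1 + 1/r)\<^sup>2 / (n + 1)\<^sup>2\<close> on the \<open>n\<close>-th unit interval.\<close>

definition weight_const :: "real \<Rightarrow> real" where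
  "weight_const r = (1 + 1/r)\<^sup>2 * (\<Sum>n. 1 / (real (Suc n))\<^sup>2)"

lemma summable_inverse_Suc_square: "summable (\<lambda>n. 1 / (real (Suc n))\<^sup>2)"
  using inverse_power_summable[of 2, where 'a = real]
  by (subst summable_Suc_iff) (simp add: inverse_eq_divide)

lemma weight_const_nonneg: "0 \<le> weight_const r"
  unfolding weight_const_def
  by (intro mult_nonneg_nonneg suminf_nonneg summable_inverse_Suc_square) auto

text \<open>Cut the half-line into unit intervals: by periodicity each carries the same integral
  \<open>I\<close>, and the constants \<open>c n\<close> bounding the weight sum to
  \<open>weight_const r\<close>. For nonnegative extended integrals the exchange with the sum is
  monotone convergence.\<close>

lemma nn_integral_periodic_over_square:
  fixes g :: "real \<Rightarrow> real"
  assumes [measurable]: "g \<in> borel_measurable borel"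
    and nonneg: "\<And>t. g t \<ge> 0" and per: "\<And>t. g (t + 1) = g t"
    and int: "set_integrable lborel {0..<1} g" and r: "r > 0"
  shows "(\<integral>\<^sup>+t. ennreal (g t / t\<^sup>2) * indicator {r..} t \<partial>lborel)
          \<le> ennreal (weight_const r * (LBINT t:{0..<1}. g t))"
proof -
  define c where "c = (\<lambda>n. (1 + 1/r)\<^sup>2 / (real (Suc n))\<^sup>2)"
  define I where "I = (LBINT t:{0..<1}. g t)"
  have I: "I \<ge> 0"
    unfolding I_def set_lebesgue_integral_def by (auto simp: nonneg intro!: integral_nonneg_AE)
  have per_nat: "g (real n + t) = g t" for n t
  proof (induction n)
    case (Suc n)
    then show ?case
      using per[of "real n + t"] by (simp add: add_ac)
  qed simp
  have pointwise: "ennreal (g t / t\<^sup>2) * indicator {r..} t \<le>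
      (\<Sum>n. ennreal (c n) * (ennreal (g t) * indicator {real n..<real n + 1} t))" (is "_ \<le> suminf ?f") for t
  proof (cases "t \<ge> r")
    case True
    define n where "n = nat \<lfloor>t\<rfloor>"
    have n: "real n \<le> t" "t < real n + 1"
      using True r unfolding n_def by (auto simp: of_nat_nat)
    have "real (Suc n) \<le> t * (1 + 1/r)"
    proof -
      have "1 \<le> t / r"
        using True r by simp
      with n show ?thesis
        by (simp add: distrib_left)
    qed
    then have "(real (Suc n))\<^sup>2 \<le> (t * (1 + 1/r))\<^sup>2"
      by (intro power_mono) auto
    then have "1 / t\<^sup>2 \<le> c n"
      using True r unfolding c_def by (simp add: divide_simps power_mult_distrib mult.commute)
    then have "g t * (1 / t\<^sup>2) \<le> g t * c n"
      by (intro mult_left_mono nonneg)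
    then have "ennreal (g t / t\<^sup>2) \<le> ?f n"
      using n nonneg by (simp add: mult.commute ennreal_leI c_def flip: ennreal_mult)
    also have "\<dots> \<le> suminf ?f"
      using sum_le_suminf[of ?f "{n}"] by simp
    finally show ?thesis
      using True by simp
  qed simp
  have shift: "(\<integral>\<^sup>+t. ennreal (g t) * indicator {real n..<real n + 1} t \<partial>lborel) = ennreal I" for n
  proof -
    have "(\<integral>\<^sup>+t. ennreal (g t) * indicator {real n..<real n + 1} t \<partial>lborel) =
          (\<integral>\<^sup>+t. ennreal (indicator {0..<1} t *\<^sub>R g t) \<partial>lborel)"
      by (subst nn_integral_real_affine[where c = 1 and t = "real n"])
         (auto simp: per_nat indicator_def intro!: nn_integral_cong)
    also have "\<dots> = ennreal I"
      unfolding I_def set_lebesgue_integral_def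
      by (rule nn_integral_eq_integral) (use int nonneg in \<open>auto simp: set_integrable_def\<close>)
    finally show ?thesis .
  qed
  have "(\<integral>\<^sup>+t. ennreal (g t / t\<^sup>2) * indicator {r..} t \<partial>lborel) \<le>
        (\<integral>\<^sup>+t. (\<Sum>n. ennreal (c n) * (ennreal (g t) * indicator {real n..<real n + 1} t)) \<partial>lborel)"
    by (intro nn_integral_mono pointwise)
  also have "\<dots> = (\<Sum>n. ennreal (c n) * ennreal I)"
    by (subst nn_integral_suminf) (auto simp: nn_integral_cmult shift)
  also have "\<dots> = (\<Sum>n. ennreal (c n)) * ennreal I"
    by (rule ennreal_suminf_multc)
  also have "(\<Sum>n. ennreal (c n)) = ennreal (\<Sum>n. c n)"
    unfolding c_def using summable_mult[OF summable_inverse_Suc_square, of "(1 + 1/r)\<^sup>2"]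
    by (intro suminf_ennreal2) auto
  also have "(\<Sum>n. c n) = weight_const r"
    unfolding c_def weight_const_def
    using suminf_mult[OF summable_inverse_Suc_square, of "(1 + 1/r)\<^sup>2"] by simp
  finally show ?thesis
    using I by (simp add: I_def ennreal_mult'')
qed

text \<open>The preceding bound, applied to the absolute value of \<open>f\<close>, is finite and
  yields integrability; this in turn converts the extended integral into the Lebesgue integral of
  the second claim.\<close>

lemma
  fixes f :: "real \<Rightarrow> real"
  assumes [measurable]: "f \<in> borel_measurable borel" and per: "\<And>t. f (t + 1) = f t"
    and int: "set_integrable lborel {0..<1} f" and r: "r > 0"
  shows set_integrable_periodic_over_square: "set_integrable lborel {r..} (\<lambda>t. f t / t\<^sup>2)"
    and LBINT_periodic_over_square_le:
      "(LBINT t:{r..}. \<bar>f t / t\<^sup>2\<bar>) \<le> weight_const r * (LBINT t:{0..<1}. \<bar>f t\<bar>)"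
proof -
  have "0 \<le> (LBINT t:{0..<1}. \<bar>f t\<bar>)"
    unfolding set_lebesgue_integral_def by (auto intro!: integral_nonneg_AE)
  then have nonneg: "0 \<le> weight_const r * (LBINT t:{0..<1}. \<bar>f t\<bar>)"
    using weight_const_nonneg by simp
  have "(\<integral>\<^sup>+t. ennreal \<bar>indicator {r..} t *\<^sub>R (f t / t\<^sup>2)\<bar> \<partial>lborel) =
        (\<integral>\<^sup>+t. ennreal (\<bar>f t\<bar> / t\<^sup>2) * indicator {r..} t \<partial>lborel)"
    by (intro nn_integral_cong) (auto simp: indicator_def)
  also have "\<dots> \<le> ennreal (weight_const r * (LBINT t:{0..<1}. \<bar>f t\<bar>))"
    using per int r by (intro nn_integral_periodic_over_square set_integrable_abs) auto
  finally have bound: "(\<integral>\<^sup>+t. ennreal \<bar>indicator {r..} t *\<^sub>R (f t / t\<^sup>2)\<bar> \<partial>lborel)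
      \<le> ennreal (weight_const r * (LBINT t:{0..<1}. \<bar>f t\<bar>))" .
  show "set_integrable lborel {r..} (\<lambda>t. f t / t\<^sup>2)"
    unfolding set_integrable_def
    by (rule integrableI_bounded) (use bound in \<open>auto simp: less_top[symmetric] top_unique\<close>)
  then have "integrable lborel (\<lambda>t. \<bar>indicator {r..} t *\<^sub>R (f t / t\<^sup>2)\<bar>)"
    unfolding set_integrable_def by (rule integrable_abs)
  then have "(\<integral>\<^sup>+t. ennreal \<bar>indicator {r..} t *\<^sub>R (f t / t\<^sup>2)\<bar> \<partial>lborel) =
     ennreal (LBINT t. \<bar>indicator {r..} t *\<^sub>R (f t / t\<^sup>2)\<bar>)"
    by (rule nn_integral_eq_integral) auto
  also have "(LBINT t. \<bar>indicator {r..} t *\<^sub>R (f t / t\<^sup>2)\<bar>) = (LBINT t:{r..}. \<bar>f t / t\<^sup>2\<bar>)"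
    by (simp add: set_lebesgue_integral_def abs_mult)
  finally have "(\<integral>\<^sup>+t. ennreal \<bar>indicator {r..} t *\<^sub>R (f t / t\<^sup>2)\<bar> \<partial>lborel) =
     ennreal (LBINT t:{r..}. \<bar>f t / t\<^sup>2\<bar>)" .
  with bound nonneg show "(LBINT t:{r..}. \<bar>f t / t\<^sup>2\<bar>) \<le> weight_const r * (LBINT t:{0..<1}. \<bar>f t\<bar>)"
    by simp
qed

section \<open>Norm estimates for the blocks between consecutive squares\<close>

text \<open>Index \<open>k\<close> stands for the integer \<open>Suc k\<close>, so the sum runs over
  the integers \<open>n\<close> with \<open>m^2 < n \<le> (m + 1)^2\<close>.\<close>

definition saw_block :: "nat \<Rightarrow> real \<Rightarrow> real" where
  "saw_block m t = (\<Sum>k=m\<^sup>2..<(Suc m)\<^sup>2. saw (real (Suc k) * t) / real (Suc k))"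

lemma saw_block_measurable [measurable]: "saw_block m \<in> borel_measurable borel"
  unfolding saw_block_def by measurable

lemma saw_block_periodic: "saw_block m (t + 1) = saw_block m t"
  using saw_add_of_nat[of "real (Suc _) * t" "Suc _"] by (simp add: saw_block_def distrib_left)

lemma saw_block_bound: "\<bar>saw_block m t\<bar> \<le> real ((Suc m)\<^sup>2)"
proof -
  have "\<bar>saw_block m t\<bar> \<le> (\<Sum>k=m\<^sup>2..<(Suc m)\<^sup>2. \<bar>saw (real (Suc k) * t) / real (Suc k)\<bar>)"
    unfolding saw_block_def by (rule sum_abs)
  also have "\<dots> \<le> (\<Sum>k=m\<^sup>2..<(Suc m)\<^sup>2. 1)"
  proof (rule sum_mono)
    fix k
    show "\<bar>saw (real (Suc k) * t) / real (Suc k)\<bar> \<le> 1"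
      using saw_bound[of "real (Suc k) * t"] by (simp add: divide_le_eq)
  qed
  also have "\<dots> \<le> real ((Suc m)\<^sup>2)"
    by (simp only: sum_constant card_atLeastLessThan mult_1_right of_nat_mono diff_le_self)
  finally show ?thesis .
qed

lemma set_integrable_saw_block: "set_integrable lborel {a..<b} (saw_block m)"
  by (rule set_integrable_bounded_Ico[OF _ saw_block_bound]) measurable

text \<open>Expanding the square leaves correlations of dilated sawtooths. The coefficients
  \<open>1 / (j k)\<close> meet the \<open>1 / (12 j k)\<close> of the correlation integral, which
  squares the denominators.\<close>

lemma LBINT_saw_block_square:
  "(LBINT t:{0..<1}. (saw_block m t)\<^sup>2) =
   (\<Sum>j=m\<^sup>2..<(Suc m)\<^sup>2. \<Sum>k=m\<^sup>2..<(Suc m)\<^sup>2.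
      (real (gcd (Suc j) (Suc k)))\<^sup>2 / (12 * (real (Suc j))\<^sup>2 * (real (Suc k))\<^sup>2))"
proof -
  have bd: "\<bar>saw x * saw y\<bar> \<le> 1/4" for x y
    using mult_mono[OF saw_bound[of x] saw_bound[of y]] by (simp add: abs_mult)
  have int: "set_integrable lborel {0..<1} (\<lambda>t. saw (real (Suc j) * t) * saw (real (Suc k) * t)
      / (real (Suc j) * real (Suc k)))" for j k
    by (intro set_integrable_divide set_integrable_bounded_Ico[OF _ bd]) measurable
  have expand: "(saw_block m t)\<^sup>2 = (\<Sum>j=m\<^sup>2..<(Suc m)\<^sup>2. \<Sum>k=m\<^sup>2..<(Suc m)\<^sup>2.
       saw (real (Suc j) * t) * saw (real (Suc k) * t) / (real (Suc j) * real (Suc k)))" for t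
    unfolding saw_block_def power2_eq_square[of "sum _ _"] sum_product times_divide_times_eq ..
  have "(LBINT t:{0..<1}. (saw_block m t)\<^sup>2) =
     (LBINT t:{0..<1}. (\<Sum>j=m\<^sup>2..<(Suc m)\<^sup>2. \<Sum>k=m\<^sup>2..<(Suc m)\<^sup>2.
       saw (real (Suc j) * t) * saw (real (Suc k) * t) / (real (Suc j) * real (Suc k))))"
    by (simp only: expand)
  also have "\<dots> = (\<Sum>j=m\<^sup>2..<(Suc m)\<^sup>2. \<Sum>k=m\<^sup>2..<(Suc m)\<^sup>2.
       (LBINT t:{0..<1}. saw (real (Suc j) * t) * saw (real (Suc k) * t) / (real (Suc j) * real (Suc k))))"
    using int unfolding set_integrable_def set_lebesgue_integral_def
    by (simp only: scaleR_sum_right Bochner_Integration.integral_sum Bochner_Integration.integrable_sum)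
  also have "\<dots> = (\<Sum>j=m\<^sup>2..<(Suc m)\<^sup>2. \<Sum>k=m\<^sup>2..<(Suc m)\<^sup>2.
      (real (gcd (Suc j) (Suc k)))\<^sup>2 / (12 * (real (Suc j))\<^sup>2 * (real (Suc k))\<^sup>2))"
  proof (intro sum.cong refl)
    fix j k
    show "(LBINT t:{0..<1}. saw (real (Suc j) * t) * saw (real (Suc k) * t) / (real (Suc j) * real (Suc k))) =
      (real (gcd (Suc j) (Suc k)))\<^sup>2 / (12 * (real (Suc j))\<^sup>2 * (real (Suc k))\<^sup>2)"
      unfolding set_integral_divide_zero LBINT_saw_mult_saw[OF zero_less_Suc zero_less_Suc]
      by (simp add: power2_eq_square mult_ac del: of_nat_Suc)
  qed
  finally show ?thesis .
qed

text \<open>The integers in the block exceed \<open>m^2\<close>. The \<open>2 m + 1\<close> diagonal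
  terms are at most \<open>m^(-4)\<close> each; off the diagonal the gcd is at most
  \<open>2 m\<close>, so each pair contributes at most \<open>m^(-6)\<close>. The diagonal dominates
  and gives the order \<open>m^(-3)\<close>.\<close>

lemma LBINT_saw_block_square_le:
  assumes "m > 0"
  shows "(LBINT t:{0..<1}. (saw_block m t)\<^sup>2) \<le> 12 / real m ^ 3"
proof -
  let ?K = "{m\<^sup>2..<(Suc m)\<^sup>2}"
  have card: "card ?K = 2 * m + 1"
    by (simp add: power2_eq_square)
  \<comment> \<open>The additive form lets the double sum split into \<open>2 m + 1\<close> copies
    of the diagonal part and \<open>(2 m + 1)^2\<close> copies of the uniform part.\<close>
  have term_le: "(real (gcd (Suc j) (Suc k)))\<^sup>2 / (12 * (real (Suc j))\<^sup>2 * (real (Suc k))\<^sup>2) \<le>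
      (if j = k then 1 / real m ^ 4 else 0) + 1 / real m ^ 6" if jk: "j \<in> ?K" "k \<in> ?K" for j k
  proof -
    have big: "real m ^ 4 \<le> (real (Suc i))\<^sup>2" if "i \<in> ?K" for i
    proof -
      have "(real m)\<^sup>2 \<le> real (Suc i)"
        using that by (simp flip: of_nat_power)
      then have "((real m)\<^sup>2)\<^sup>2 \<le> (real (Suc i))\<^sup>2"
        by (intro power_mono) auto
      then show ?thesis
        by simp
    qed
    show ?thesis
    proof (cases "j = k")
      case True
      have "(real (gcd (Suc j) (Suc k)))\<^sup>2 / (12 * (real (Suc j))\<^sup>2 * (real (Suc k))\<^sup>2) =
            1 / (12 * (real (Suc j))\<^sup>2)"
        using True by (simp add: power2_eq_square del: of_nat_Suc)
      also have "\<dots> \<le> 1 / real m ^ 4"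
      proof (intro divide_left_mono mult_pos_pos)
        show "real m ^ 4 \<le> 12 * (real (Suc j))\<^sup>2"
          using big[OF jk(1)] zero_le_power2[of "real (Suc j)"] by linarith
      qed (use assms in auto)
      finally show ?thesis
        using True by (simp add: add_increasing2)
    next
      case False
      \<comment> \<open>A common divisor divides the difference, and two indices in a block of
        length \<open>2 m + 1\<close> differ by at most \<open>2 m\<close>.\<close>
      have le: "gcd (Suc a) (Suc b) \<le> 2 * m" if "a < b" "a \<in> ?K" "b \<in> ?K" for a b
      proof -
        have "gcd (Suc a) (Suc b) dvd Suc b - Suc a"
          by (intro dvd_diff_nat) auto
        then have "gcd (Suc a) (Suc b) \<le> b - a"
          using that by (intro dvd_imp_le) auto
        also have "\<dots> \<le> 2 * m"
          using that by (auto simp: power2_eq_square)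
        finally show ?thesis .
      qed
      have "gcd (Suc j) (Suc k) \<le> 2 * m"
        using le[of j k] le[of k j] False jk by (cases "j < k") (auto simp: gcd.commute)
      then have "(real (gcd (Suc j) (Suc k)))\<^sup>2 \<le> (real (2 * m))\<^sup>2"
        by (intro power_mono) (auto simp del: of_nat_mult)
      then have "(real (gcd (Suc j) (Suc k)))\<^sup>2 / (12 * (real (Suc j))\<^sup>2 * (real (Suc k))\<^sup>2)
           \<le> (real (2 * m))\<^sup>2 / (12 * real m ^ 4 * real m ^ 4)"
        using big[OF jk(1)] big[OF jk(2)] assms by (intro frac_le mult_mono mult_pos_pos) auto
      also have "\<dots> = 1 / (3 * real m ^ 6)"
        using assms by (simp add: field_simps eval_nat_numeral)
      also have "\<dots> \<le> 1 / real m ^ 6"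
        using assms by (intro divide_left_mono mult_pos_pos) auto
      finally show ?thesis
        using False by simp
    qed
  qed
  have "(LBINT t:{0..<1}. (saw_block m t)\<^sup>2) \<le>
      (\<Sum>j\<in>?K. \<Sum>k\<in>?K. (if j = k then 1 / real m ^ 4 else 0) + 1 / real m ^ 6)"
    unfolding LBINT_saw_block_square by (intro sum_mono term_le)
  also have "\<dots> = real (2 * m + 1) / real m ^ 4 + (real (2 * m + 1))\<^sup>2 / real m ^ 6"
    unfolding sum.distrib sum.delta[OF finite_atLeastLessThan] sum_constant card
    by (simp add: power2_eq_square add_divide_distrib distrib_left)
  \<comment> \<open>For \<open>m \<ge> 1\<close> one has \<open>2 m + 1 \<le> 3 m\<close>; the final
    constant is then \<open>3 + 9 = 12\<close>.\<close>
  also have "\<dots> \<le> (3 * real m) / real m ^ 4 + (3 * real m)\<^sup>2 / real m ^ 6"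
    using assms by (intro add_mono divide_right_mono power_mono) auto
  also have "\<dots> = 3 / real m ^ 3 + 9 / real m ^ 4"
    using assms by (simp add: field_simps eval_nat_numeral)
  also have "9 / real m ^ 4 \<le> 9 / real m ^ 3"
    using assms by (intro divide_left_mono power_increasing) auto
  finally show ?thesis
    by (simp flip: add_divide_distrib)
qed

text \<open>Cauchy--Schwarz in the form \<open>2 \<bar>D\<bar> \<le> e + D\<^sup>2 / e\<close> with the optimal scale \<open>e = m powr (-3/2)\<close>.\<close>

lemma LBINT_abs_saw_block_le:
  assumes "m > 0"
  shows "(LBINT t:{0..<1}. \<bar>saw_block m t\<bar>) \<le> 7 * real m powr (-3/2)"
proof -
  define e where "e = real m powr (-3/2)"
  have e: "e > 0"
    using assms by (simp add: e_def)
  have "e * e = real m powr (-3)"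
    by (simp add: e_def flip: powr_add)
  then have ee: "e * e = 1 / real m ^ 3"
    using assms by (simp add: powr_minus powr_numeral inverse_eq_divide)
  have "\<bar>(saw_block m t)\<^sup>2\<bar> \<le> (real ((Suc m)\<^sup>2))\<^sup>2" for t
    using power_mono[OF saw_block_bound[of m t], of 2] by simp
  then have int: "set_integrable lborel {0..<1} (\<lambda>t. (saw_block m t)\<^sup>2)"
    by (rule set_integrable_bounded_Ico[rotated]) measurable
  have inte: "set_integrable lborel {0..<1} (\<lambda>t::real. e / 2)"
    by (rule set_integrable_bounded_Ico[where C = "e/2"]) (use e in auto)
  have "(LBINT t:{0..<1}. \<bar>saw_block m t\<bar>) \<le> (LBINT t:{0..<1}. e / 2 + (saw_block m t)\<^sup>2 / (2 * e))"
  proof (rule set_integral_mono)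
    fix t
    have "0 \<le> (\<bar>saw_block m t\<bar> - e)\<^sup>2"
      by simp
    then have "2 * e * \<bar>saw_block m t\<bar> \<le> e\<^sup>2 + (saw_block m t)\<^sup>2"
      by (simp add: power2_diff mult_ac)
    then show "\<bar>saw_block m t\<bar> \<le> e / 2 + (saw_block m t)\<^sup>2 / (2 * e)"
      using e by (simp add: field_simps power2_eq_square)
  qed (use int inte in \<open>auto intro!: set_integrable_abs set_integrable_saw_block set_integral_add\<close>)
  also have "\<dots> = (LBINT t:{0..<1::real}. e / 2) + (LBINT t:{0..<1}. (saw_block m t)\<^sup>2) / (2 * e)"
    using int inte by (subst set_integral_add) auto
  also have "(LBINT t:{0..<1::real}. e / 2) = e / 2"
    by (simp add: set_lebesgue_integral_def)
  also have "(LBINT t:{0..<1}. (saw_block m t)\<^sup>2) / (2 * e) \<le> (12 * (e * e)) / (2 * e)"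
    using LBINT_saw_block_square_le[OF assms] e unfolding ee by (intro divide_right_mono) auto
  also have "e / 2 + (12 * (e * e)) / (2 * e) = 13/2 * e"
    using e by simp
  also have "13/2 * e \<le> 7 * e"
    using e by simp
  finally show ?thesis
    by (simp add: e_def)
qed

section \<open>The remainder \<open>R1\<close> as a sawtooth integral\<close>

text \<open>The right endpoint can be included because at an integer \<open>N\<close> the jump
  \<open>1 / N\<close> of \<open>H\<close> cancels the jump of the sawtooth term. This continuity of
  \<open>R1\<close> is what lets consecutive intervals be glued.\<close>

lemma R1_eq_on_unit_interval:
  assumes "0 < t" "real n \<le> t" "t \<le> real n + 1"
  shows "R1 t = ln t + euler_mascheroni - harm n - 1 + (real n + 1/2) / t"
proof (cases "t = real n + 1")
  case True
  then have "t = real (Suc n)"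
    by simp
  then have "H t = harm (Suc n)" "frac t = 0"
    by (simp_all add: H_def del: of_nat_Suc)
  then have "R1 t = ln t + euler_mascheroni - harm (Suc n) + 1 / (2 * t)"
    by (simp add: R1_def del: frac_eq_0_iff)
  also have "harm (Suc n) = harm n + inverse t"
    using True by (simp add: harm_Suc add.commute)
  also have "inverse t = 1 / (2 * t) + 1 / (2 * t)"
    by (simp add: field_simps)
  finally have "R1 t = ln t + euler_mascheroni - harm n - 1 / (2 * t)"
    by simp
  moreover have "(real n + 1/2) / t = 1 - 1 / (2 * t)"
    unfolding True by (simp add: divide_simps)
  ultimately show ?thesis
    by simp
next
  case False
  with assms have "\<lfloor>t\<rfloor> = int n"
    by (intro floor_unique) auto
  then have "H t = harm n" "frac t = t - real n"
    by (simp_all add: H_def frac_def)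
  then show ?thesis
    using assms(1) by (simp add: R1_def field_simps)
qed

text \<open>\<open>G\<close> is the smooth branch of \<open>R1\<close> on this interval. Its
  derivative is compared with the integrand in the interior only, so the jump of \<open>saw\<close>
  at \<open>n + 1\<close> is harmless.\<close>

lemma has_integral_saw_over_square_piece:
  assumes "0 < a" "real n \<le> a" "a \<le> b" "b \<le> real n + 1"
  shows "((\<lambda>t. saw t / t\<^sup>2) has_integral (R1 b - R1 a)) {a..b}"
proof -
  define G where "G = (\<lambda>t. ln t + euler_mascheroni - harm n - 1 + (real n + 1/2) / t)"
  have "((\<lambda>t. saw t / t\<^sup>2) has_integral (G b - G a)) {a..b}"
  proof (rule fundamental_theorem_of_calculus_interior)
    show "continuous_on {a..b} G"
      unfolding G_def using assms by (auto intro!: continuous_intros)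
    fix t assume t: "t \<in> {a<..<b}"
    with assms have "\<lfloor>t\<rfloor> = int n"
      by (intro floor_unique) auto
    then have "saw t = t - (real n + 1/2)"
      by (simp add: saw_def frac_def)
    moreover have "1 / t = t / t\<^sup>2"
      by (simp add: power2_eq_square)
    ultimately have "1 / t - (real n + 1/2) / t\<^sup>2 = saw t / t\<^sup>2"
      by (simp only: diff_divide_distrib)
    moreover have "(G has_real_derivative (1 / t - (real n + 1/2) / t\<^sup>2)) (at t)"
      unfolding G_def using t assms
      by (auto intro!: derivative_eq_intros simp: power2_eq_square diff_divide_distrib add_divide_distrib)
    ultimately have "(G has_real_derivative (saw t / t\<^sup>2)) (at t)"
      by simp
    then show "(G has_vector_derivative (saw t / t\<^sup>2)) (at t)"
      by (simp add: has_real_derivative_iff_has_vector_derivative)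
  qed fact
  moreover have "R1 a = G a" "R1 b = G b"
    using assms by (simp_all add: G_def R1_eq_on_unit_interval)
  ultimately show ?thesis
    by simp
qed

lemma has_integral_saw_over_square:
  assumes "x > 0"
  shows "((\<lambda>t. saw t / t\<^sup>2) has_integral (R1 (real (nat \<lceil>x\<rceil> + j)) - R1 x)) {x..real (nat \<lceil>x\<rceil> + j)}"
proof (induction j)
  case 0
  \<comment> \<open>Then \<open>n < x \<le> n + 1\<close>, so the first stretch from
    \<open>x\<close> to its ceiling lies in one unit interval; it is a single point when
    \<open>x\<close> is an integer.\<close>
  define n where "n = nat \<lceil>x\<rceil> - 1"
  have "nat \<lceil>x\<rceil> > 0"
    using assms by simp
  then have n: "nat \<lceil>x\<rceil> = Suc n"
    by (simp add: n_def)
  moreover have "real n < x" "x \<le> real (Suc n)"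
    using assms n by linarith+
  ultimately show ?case
    using has_integral_saw_over_square_piece[of x n "real (Suc n)"] assms by simp
next
  case (Suc j)
  let ?c = "real (nat \<lceil>x\<rceil> + j)"
  have c: "x \<le> ?c"
    by linarith
  have "((\<lambda>t. saw t / t\<^sup>2) has_integral (R1 (?c + 1) - R1 ?c)) {?c..?c + 1}"
    using assms c has_integral_saw_over_square_piece[of ?c "nat \<lceil>x\<rceil> + j" "?c + 1"] by simp
  from has_integral_combine[OF c _ Suc.IH this] show ?case
    by (simp add: add_ac)
qed

text \<open>This is the limit defining Euler's constant, with the sawtooth term equal to
  \<open>1 / (2 n)\<close> at integers. The truncated integrals end at such points.\<close>

lemma R1_tendsto_0: "(\<lambda>n. R1 (real n)) \<longlonglongrightarrow> 0"
proof -
  have "(\<lambda>n. euler_mascheroni - (harm n - ln (real n)) + (1/2) / real n) \<longlonglongrightarrow>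
        euler_mascheroni - euler_mascheroni + (0 :: real)"
    by (intro tendsto_intros euler_mascheroni_LIMSEQ lim_const_over_n)
  moreover have "R1 (real n) = euler_mascheroni - (harm n - ln (real n)) + (1/2) / real n" for n
  proof -
    have "frac (real n) = 0"
      by simp
    then show ?thesis
      by (simp add: R1_def H_def del: frac_eq_0_iff)
  qed
  ultimately show ?thesis
    by simp
qed

text \<open>Each term has period 1 and size at most \<open>1 / Suc k\<close>. Once the integral is
  identified with \<open>R1\<close>, the second claim says that \<open>R1 (k r)\<close> is
  \<open>O(1/k)\<close>, as required for passing from squares to all partial sums.\<close>

lemma
  assumes "r > 0"
  shows set_integrable_saw_mult_over_square:
      "set_integrable lborel {r..} (\<lambda>t. saw (real (Suc k) * t) / real (Suc k) / t\<^sup>2)"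
    and LBINT_saw_mult_over_square_le:
      "\<bar>LBINT t:{r..}. saw (real (Suc k) * t) / real (Suc k) / t\<^sup>2\<bar> \<le> weight_const r / real (Suc k)"
proof -
  define f where "f = (\<lambda>t. saw (real (Suc k) * t) / real (Suc k))"
  have [measurable]: "f \<in> borel_measurable borel"
    unfolding f_def by measurable
  have per: "f (t + 1) = f t" for t
    using saw_add_of_nat[of "real (Suc k) * t" "Suc k"] by (simp add: f_def distrib_left)
  have bd: "\<bar>f t\<bar> \<le> 1 / real (Suc k)" for t
    using saw_bound[of "real (Suc k) * t"] by (simp add: f_def divide_right_mono)
  have int: "set_integrable lborel {0..<1} f"
    by (rule set_integrable_bounded_Ico[OF _ bd]) measurable
  show *: "set_integrable lborel {r..} (\<lambda>t. f t / t\<^sup>2)"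
    by (rule set_integrable_periodic_over_square) (use assms per int in auto)
  have "\<bar>LBINT t:{r..}. f t / t\<^sup>2\<bar> \<le> (LBINT t:{r..}. \<bar>f t / t\<^sup>2\<bar>)"
    unfolding set_lebesgue_integral_def
    using integral_abs_bound[of lborel "\<lambda>t. indicator {r..} t *\<^sub>R (f t / t\<^sup>2)"]
    by (simp add: abs_mult)
  also have "\<dots> \<le> weight_const r * (LBINT t:{0..<1}. \<bar>f t\<bar>)"
    by (rule LBINT_periodic_over_square_le) (use assms per int in auto)
  also have "\<dots> \<le> weight_const r * (1 / real (Suc k))"
  proof (rule mult_left_mono)
    have "set_integrable lborel {0..<1::real} (\<lambda>t. 1 / real (Suc k))"
      by (rule set_integrable_bounded_Ico[where C = "1 / real (Suc k)"]) auto
    then have "(LBINT t:{0..<1}. \<bar>f t\<bar>) \<le> (LBINT t:{0..<1::real}. 1 / real (Suc k))"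
      by (intro set_integral_mono set_integrable_abs int bd)
    then show "(LBINT t:{0..<1}. \<bar>f t\<bar>) \<le> 1 / real (Suc k)"
      by (simp add: set_lebesgue_integral_def)
    show "0 \<le> weight_const r"
      by (rule weight_const_nonneg)
  qed
  finally show "\<bar>LBINT t:{r..}. f t / t\<^sup>2\<bar> \<le> weight_const r / real (Suc k)"
    by simp
qed

text \<open>Integrate up to the integers \<open>X j\<close> and let \<open>j\<close> grow; the
  boundary term \<open>R1 (X j)\<close> tends to 0.\<close>

lemma LBINT_saw_over_square:
  assumes "x > 0"
  shows "(LBINT t:{x..}. saw t / t\<^sup>2) = - R1 x"
proof -
  define X where "X = (\<lambda>j. real (nat \<lceil>x\<rceil> + j))"
  have int: "set_integrable lborel {x..} (\<lambda>t. saw t / t\<^sup>2)"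
    using set_integrable_saw_mult_over_square[OF assms, of 0] by simp
  have "(LBINT t:{x..X j}. saw t / t\<^sup>2) = R1 (X j) - R1 x" for j
  proof -
    have "set_integrable lborel {x..X j} (\<lambda>t. saw t / t\<^sup>2)"
      by (rule set_integrable_subset[OF int]) auto
    then have "(LBINT t:{x..X j}. saw t / t\<^sup>2) = integral {x..X j} (\<lambda>t. saw t / t\<^sup>2)"
      by (rule set_borel_integral_eq_integral)
    also have "\<dots> = R1 (X j) - R1 x"
      unfolding X_def by (rule integral_unique[OF has_integral_saw_over_square[OF assms]])
    finally show ?thesis .
  qed
  moreover have "(\<lambda>j. R1 (X j) - R1 x) \<longlonglongrightarrow> 0 - R1 x"
    unfolding X_def using LIMSEQ_ignore_initial_segment[OF R1_tendsto_0, of "nat \<lceil>x\<rceil>"]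
    by (intro tendsto_diff tendsto_const) (simp add: add.commute)
  moreover have "filterlim X at_top sequentially"
    by (rule filterlim_at_top_mono[OF filterlim_real_sequentially]) (simp add: X_def)
  then have "(\<lambda>j. LBINT t:{x..X j}. saw t / t\<^sup>2) \<longlonglongrightarrow> (LBINT t:{x..}. saw t / t\<^sup>2)"
    by (intro filterlim_compose[OF tendsto_set_lebesgue_integral_at_top] int) auto
  ultimately show ?thesis
    using LIMSEQ_unique by fastforce
qed

text \<open>Substitute \<open>u = c t\<close>: the Jacobian \<open>c\<close> and the factor
  \<open>1 / c^2\<close> from the weight combine to \<open>1 / c\<close>.\<close>

lemma LBINT_saw_mult_over_square:
  assumes "r > 0"
  shows "(LBINT t:{r..}. saw (real (Suc k) * t) / real (Suc k) / t\<^sup>2) = - R1 (real (Suc k) * r)"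
proof -
  define c where "c = real (Suc k)"
  have c: "c > 0"
    by (simp add: c_def)
  have "- R1 (c * r) = (LBINT u:{c * r..}. saw u / u\<^sup>2)"
    using assms c by (simp add: LBINT_saw_over_square)
  also have "\<dots> = c * (LBINT t. indicator {c * r..} (c * t) * (saw (c * t) / (c * t)\<^sup>2))"
    unfolding set_lebesgue_integral_def
    using lborel_integral_real_affine[of c "\<lambda>u. indicator {c * r..} u *\<^sub>R (saw u / u\<^sup>2)" 0] c
    by simp
  also have "\<dots> = (LBINT t:{r..}. saw (c * t) / c / t\<^sup>2)"
    unfolding set_lebesgue_integral_def
    by (subst integral_mult_right_zero[symmetric], rule Bochner_Integration.integral_cong)
       (use c in \<open>auto simp: indicator_def power2_eq_square\<close>)
  finally show ?thesis
    by (simp add: c_def)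
qed

section \<open>Termwise integration and conclusion\<close>

text \<open>By monotone convergence the sum of the norms has finite integral, hence is finite almost
  everywhere.\<close>

lemma AE_summable_norm:
  fixes f :: "nat \<Rightarrow> 'a \<Rightarrow> 'b :: {banach, second_countable_topology}"
  assumes [measurable]: "\<And>i. integrable M (f i)" and sum: "summable (\<lambda>i. \<integral>x. norm (f i x) \<partial>M)"
  shows "AE x in M. summable (\<lambda>i. norm (f i x))"
proof -
  have "(\<integral>\<^sup>+x. (\<Sum>i. ennreal (norm (f i x))) \<partial>M) = (\<Sum>i. ennreal (\<integral>x. norm (f i x) \<partial>M))"
    using assms(1) by (subst nn_integral_suminf) (auto simp: nn_integral_eq_integral)
  also have "\<dots> \<noteq> top"
    using sum by (intro ennreal_suminf_neq_top) auto
  finally have "AE x in M. (\<Sum>i. ennreal (norm (f i x))) \<noteq> \<infinity>"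
    by (intro nn_integral_PInf_AE) auto
  then show ?thesis
    by eventually_elim (auto intro: summable_suminf_not_top)
qed

lemma sum_square_blocks:
  fixes a :: "nat \<Rightarrow> 'a :: comm_monoid_add"
  shows "(\<Sum>m<M. \<Sum>k=m\<^sup>2..<(Suc m)\<^sup>2. a k) = (\<Sum>k<M\<^sup>2. a k)"
proof (induction M)
  case (Suc M)
  have "(\<Sum>k<M\<^sup>2. a k) + (\<Sum>k=M\<^sup>2..<(Suc M)\<^sup>2. a k) = (\<Sum>k<(Suc M)\<^sup>2. a k)"
    unfolding lessThan_atLeast0 by (rule sum.atLeastLessThan_concat) (auto simp: power2_eq_square)
  with Suc show ?case
    by simp
qed simp

theorem proposition5p1:
  fixes r :: real
  assumes "r > 0"
  shows "set_integrable lborel {r..} (\<lambda>t. phi1 t / t\<^sup>2)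
    \<and> S1 r = - (LBINT t:{r..}. phi1 t / t\<^sup>2)"
proof -
  define f where "f = (\<lambda>m t. indicator {r..} t *\<^sub>R (saw_block m t / t\<^sup>2))"
  define I where "I = (LBINT t:{r..}. phi1 t / t\<^sup>2)"
  have int: "integrable lborel (f m)" for m
    using set_integrable_periodic_over_square[OF saw_block_measurable saw_block_periodic
        set_integrable_saw_block assms]
    by (simp add: f_def set_integrable_def)
  have norm_le: "(LBINT t. norm (f m t)) \<le> weight_const r * (LBINT t:{0..<1}. \<bar>saw_block m t\<bar>)" for m
    using LBINT_periodic_over_square_le[OF saw_block_measurable saw_block_periodic
        set_integrable_saw_block assms]
    by (simp add: f_def set_lebesgue_integral_def abs_mult)
  have summable: "summable (\<lambda>m. LBINT t. norm (f m t))"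
  proof (rule summable_comparison_test_ev)
    have "norm (LBINT t. norm (f m t)) \<le> weight_const r * (7 * real m powr (-3/2))" if "m > 0" for m
      using order_trans[OF norm_le mult_left_mono[OF LBINT_abs_saw_block_le[OF that] weight_const_nonneg]]
      by simp
    then show "\<forall>\<^sub>F m in sequentially. norm (LBINT t. norm (f m t)) \<le>
        weight_const r * (7 * real m powr (-3/2))"
      by (rule eventually_mono[OF eventually_gt_at_top[of 0]])
    \<comment> \<open>The exponent lies below \<open>-1\<close>. Without grouping, the norms of the
      single terms are of order \<open>1/k\<close> and their sum diverges.\<close>
    show "summable (\<lambda>m. weight_const r * (7 * real m powr (-3/2)))"
      by (intro summable_mult) (simp add: summable_real_powr_iff)
  qed
  have AE_summable: "AE t in lborel. summable (\<lambda>m. norm (f m t))"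
    by (rule AE_summable_norm[OF int summable])
  have "phi1 t / t\<^sup>2 = (\<Sum>m. f m t)" if t: "t \<ge> r" and *: "summable (\<lambda>m. norm (f m t))" for t
  proof -
    have t2: "t\<^sup>2 > 0"
      using t assms by simp
    have "(\<lambda>m. f m t) sums (\<Sum>m. f m t)"
      by (rule summable_sums[OF summable_norm_cancel[OF *]])
    \<comment> \<open>Removing the weight recovers the blocks, whose partial sums are those of the
      series for \<open>phi1\<close> at squares.\<close>
    then have "(\<lambda>m. t\<^sup>2 * f m t) sums (t\<^sup>2 * (\<Sum>m. f m t))"
      by (rule sums_mult)
    also have "(\<lambda>m. t\<^sup>2 * f m t) = (\<lambda>m. saw_block m t)"
      using t t2 by (simp add: f_def fun_eq_iff)
    finally have "(\<lambda>M. \<Sum>k<M\<^sup>2. saw (real (Suc k) * t) / real (Suc k)) \<longlonglongrightarrow> t\<^sup>2 * (\<Sum>m. f m t)"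
      unfolding sums_def saw_block_def sum_square_blocks .
    \<comment> \<open>This bound extends convergence from the squares to the full series, so
      \<open>phi1 t\<close> is a genuine limit here.\<close>
    moreover have "\<bar>saw (real (Suc k) * t) / real (Suc k)\<bar> \<le> (1/2) / real (Suc k)" for k
      unfolding abs_divide abs_of_nat by (intro divide_right_mono saw_bound) auto
    ultimately have "(\<lambda>k. saw (real (Suc k) * t) / real (Suc k)) sums (t\<^sup>2 * (\<Sum>m. f m t))"
      by (intro sums_of_square_partial_sums)
    then have "phi1 t = t\<^sup>2 * (\<Sum>m. f m t)"
      unfolding phi1_def saw_def[symmetric] by (rule sums_unique[symmetric])
    then show ?thesis
      using t2 by simp
  qed
  then have eq: "AE t in lborel. (\<Sum>m. f m t) = indicator {r..} t *\<^sub>R (phi1 t / t\<^sup>2)"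
    by (intro eventually_mono[OF AE_summable]) (auto simp: f_def indicator_def)
  have [measurable]: "phi1 \<in> borel_measurable borel" "f m \<in> borel_measurable borel" for m
    unfolding phi1_def saw_def[symmetric] f_def by measurable
  have "integrable lborel (\<lambda>t. \<Sum>m. f m t)"
    by (rule integrable_suminf[OF int AE_summable summable])
  then have integrable: "set_integrable lborel {r..} (\<lambda>t. phi1 t / t\<^sup>2)"
    unfolding set_integrable_def using integrable_cong_AE[OF _ _ eq] by auto
  have "(\<lambda>m. integral\<^sup>L lborel (f m)) sums (LBINT t. \<Sum>m. f m t)"
    by (rule sums_integral[OF int AE_summable summable])
  also have "(LBINT t. \<Sum>m. f m t) = I"
    unfolding I_def set_lebesgue_integral_def by (rule integral_cong_AE[OF _ _ eq]) auto
  also have "(\<lambda>m. integral\<^sup>L lborel (f m)) = (\<lambda>m. \<Sum>k=m\<^sup>2..<(Suc m)\<^sup>2. - R1 (real (Suc k) * r))"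
  proof
    fix m
    have expand: "f m = (\<lambda>t. \<Sum>k=m\<^sup>2..<(Suc m)\<^sup>2.
        indicator {r..} t *\<^sub>R (saw (real (Suc k) * t) / real (Suc k) / t\<^sup>2))"
      unfolding f_def saw_block_def sum_divide_distrib scaleR_sum_right ..
    show "integral\<^sup>L lborel (f m) = (\<Sum>k=m\<^sup>2..<(Suc m)\<^sup>2. - R1 (real (Suc k) * r))"
      using set_integrable_saw_mult_over_square[OF assms] LBINT_saw_mult_over_square[OF assms]
      unfolding set_integrable_def set_lebesgue_integral_def expand
      by (subst Bochner_Integration.integral_sum) simp_all
  qed
  finally have "(\<lambda>M. \<Sum>k<M\<^sup>2. - R1 (real (Suc k) * r)) \<longlonglongrightarrow> I"
    unfolding sums_def sum_square_blocks .
  \<comment> \<open>The integral estimate, read through the identification with \<open>R1\<close>,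
    again permits the passage from squares to the full series.\<close>
  moreover have "\<bar>- R1 (real (Suc k) * r)\<bar> \<le> weight_const r / real (Suc k)" for k
    using LBINT_saw_mult_over_square_le[OF assms, of k] unfolding LBINT_saw_mult_over_square[OF assms] .
  ultimately have "(\<lambda>k. - R1 (real (Suc k) * r)) sums I"
    by (intro sums_of_square_partial_sums)
  then have "(\<lambda>k. R1 (real (Suc k) * r)) sums (- I)"
    using sums_minus by fastforce
  then have "S1 r = - I"
    unfolding S1_def by (rule sums_unique[symmetric])
  with integrable show ?thesis
    by (simp add: I_def)
qed

end
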